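(* Let $Y$ be a proper geodesic metric space. The topology of fellow-traveling quasi-geodesics $\mathcal{FQ}$ on the Morse boundary $\partial_M Y$ is independent of the choice of the base point $o\in Y$; that is, for any $o,o'\in Y$ the topologies $\mathcal{FQ}$ defined using $o$ and using $o'$ are equal. If $Y$ is $\mathrm{CAT}(0)$, then the topology of fellow-traveling geodesics $\mathcal{FG}$ on $\partial_M Y$ is also independent of the choice of the base point $o$.
   Context: **Morse boundary.** Let $(Y,d)$ be a proper geodesic metric space. Two quasi-geodesic rays are equivalent if they have finite Hausdorff distance. For $N:\mathbb{R}_{\ge 1}\times\mathbb{R}_{\ge 0}\to\mathbb{R}_{\ge 0}$, a set $S\subset Y$ is $N$-Morse if every $(K,C)$-quasi-geodesic with endpoints in $S$ lies in the closed $N(K,C)$-neighbourhood of $S$; $S$ is Morse if it is $N$-Morse for some $N$. The Morse boundary $\partial_M Y$ is the set of equivalence classes of quasi-geodesic rays containing a quasi-geodesic ray whose image is Morse. A representative of $\xi\in\partial_M Y$ is a quasi-geodesic ray in the class $\xi$; it is based at $o$ if it starts at $o$. **Contracting sets.** Let $\rho:\mathbb{R}_{\ge 0}\to\mathbb{R}_{\ge 0}$ be non-decreasing and sublinear, i.e. $\lim_{r\to\infty}\rho(r)/r=0$. For closed $S\subset Y$ let $\pi_S(y)$ be the set of points of $S$ closest to $y$. $S$ is $\rho$-contracting if for all $x,y\in Y\setminus S$ with $d(x,y)<d(S,y)$ one has $\operatorname{diam}(\pi_S(x)\cup\pi_S(y))\le\rho(d(S,y))$. For each $\xi\in\partial_M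 Y$ and $o\in Y$ there is such a $\rho$ for which all geodesic representatives of $\xi$ based at $o$ are $\rho$-contracting. For $K\ge 1$, $C\ge 0$ put $$\kappa(\rho,K,C):=\max\bigl(3K^2,\,3C,\,1+\inf\{R \mid \forall r\ge R,\ 3K^2\rho(r)\le r\}\bigr).$$ **Topologies $\mathcal{FQ}$ and $\mathcal{FG}$.** Fix a base point $o\in Y$. For each $\xi\in\partial_M Y$ choose $\rho$ such that all geodesic representatives of $\xi$ based at $o$ are $\rho$-contracting, and choose a geodesic representative $\gamma$ of $\xi$ based at $o$. For $R\ge 0$, a $(K,C)$-quasi-geodesic $\beta$ fellow-travels along $\gamma$ for distance $R$ if some point of $\beta$ lies at distance at most $\kappa(\rho,K,C)$ from some point of $\gamma\setminus B_R(o)$, where $B_R(o)$ is the open ball of radius $R$ centered at $o$ (for a geodesic, $(K,C)=(1,0)$). Let $U_{o,R}(\xi)$ be the set of $\eta\in\partial_M Y$ such that all quasi-geodesic representatives of $\eta$ based at $o$ fellow-travel along $\gamma$ for distance $R$, and let $V_{o,R}(\xi)$ be the set of $\eta\in\partial_M Y$ such that all geodesic representatives of $\eta$ based at $o$ fellow-travel along $\gamma$ for distance $R$. A set $U\subset\partial_M Y$ is open in $\mathcal{FQ}$ iff for every $\xi\in U$ there is $R>0$ with $U_{o,R}(\xi)\subset U$; a set $V\subset\partial_M Y$ is open in $\mathcal{FG}$ iff for every $\xi\in V$ there is $R>0$ with $V_{o,R}(\xi)\subset V$. *)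

theory Defs
  imports "HOL-Analysis.Analysis"
begin

text \<open>
  The space \<open>Y\<close> is the universe of a type of class \<open>metric_space\<close>.
\<close>

definition proper_space :: "'a::metric_space itself \<Rightarrow> bool" where
  "proper_space _ \<longleftrightarrow> (\<forall>(x::'a) r. compact (cball x r))"

definition geodesic_joining :: "(real \<Rightarrow> 'a::metric_space) \<Rightarrow> 'a \<Rightarrow> 'a \<Rightarrow> bool" where
  "geodesic_joining g x y \<longleftrightarrow> g 0 = x \<and> g (dist x y) = y \<and>
     (\<forall>s\<in>{0..dist x y}. \<forall>t\<in>{0..dist x y}. dist (g s) (g t) = \<bar>s - t\<bar>)"

definition geodesic_space :: "'a::metric_space itself \<Rightarrow> bool" where
  "geodesic_space _ \<longleftrightarrow> (\<forall>(x::'a) y. \<exists>g. geodesic_joining g x y)"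


section \<open>CAT(0) spaces\<close>

text \<open>
  Pairs \<open>(p, p')\<close> consisting of a point \<open>p\<close> on the side \<open>g\<close>, which joins \<open>x\<close> to \<open>y\<close>,
  and its comparison point \<open>p'\<close> on the Euclidean side from \<open>x'\<close> to \<open>y'\<close>.
\<close>
definition comparison_pairs ::
    "(real \<Rightarrow> 'a::metric_space) \<Rightarrow> 'a \<Rightarrow> 'a \<Rightarrow> (real^2) \<Rightarrow> (real^2) \<Rightarrow> ('a \<times> (real^2)) set" where
  "comparison_pairs g x y x' y' =
     {(p, p'). p \<in> g ` {0..dist x y} \<and> p' \<in> closed_segment x' y' \<and> dist x' p' = dist x p}"

definition CAT0_space :: "'a::metric_space itself \<Rightarrow> bool" where
  "CAT0_space _ \<longleftrightarrow> geodesic_space TYPE('a) \<and>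
     (\<forall>(x::'a) y z f g h. \<forall>x' y' z'.
        geodesic_joining f x y \<and> geodesic_joining g y z \<and> geodesic_joining h z x \<and>
        dist x' y' = dist x y \<and> dist y' z' = dist y z \<and> dist z' x' = dist z x \<longrightarrow>
        (let P = comparison_pairs f x y x' y' \<union> comparison_pairs g y z y' z'
                   \<union> comparison_pairs h z x z' x'
         in \<forall>(p, p')\<in>P. \<forall>(q, q')\<in>P. dist p q \<le> dist p' q'))"


section \<open>Quasi-geodesics and the Morse boundary\<close>

definition quasi_geodesic_on ::
    "real \<Rightarrow> real \<Rightarrow> real set \<Rightarrow> (real \<Rightarrow> 'a::metric_space) \<Rightarrow> bool" where
  "quasi_geodesic_on K C I q \<longleftrightarrow> 1 \<le> K \<and> 0 \<le> C \<and>
     (\<forall>s\<in>I. \<forall>t\<in>I. \<bar>s - t\<bar> / K - C \<le> dist (q s) (q t) \<and> dist (q s) (q t) \<le> K * \<bar>s - t\<bar> + C)"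

text \<open>
  A ray is a function on all of \<open>real\<close> of which only the restriction to \<open>{0..}\<close> matters.
  The values at negative arguments are arbitrary; they affect neither the predicates below nor
  the equivalence of rays, so that equivalence classes are unchanged up to this convention.
\<close>
definition ray_image :: "(real \<Rightarrow> 'a) \<Rightarrow> 'a set" where
  "ray_image \<beta> = \<beta> ` {0..}"

definition quasi_geodesic_rays :: "(real \<Rightarrow> 'a::metric_space) set" where
  "quasi_geodesic_rays = {\<beta>. \<exists>K C. quasi_geodesic_on K C {0..} \<beta>}"

definition geodesic_ray :: "(real \<Rightarrow> 'a::metric_space) \<Rightarrow> bool" where
  "geodesic_ray \<beta> \<longleftrightarrow> (\<forall>s\<ge>0. \<forall>t\<ge>0. dist (\<beta> s) (\<beta> t) = \<bar>s - t\<bar>)"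

definition hausdorff_distance :: "'a::metric_space set \<Rightarrow> 'a set \<Rightarrow> ereal" where
  "hausdorff_distance A B = Inf {ereal r |r. 0 \<le> r \<and>
     (\<forall>a\<in>A. \<exists>b\<in>B. dist a b \<le> r) \<and> (\<forall>b\<in>B. \<exists>a\<in>A. dist a b \<le> r)}"

definition ray_equiv :: "((real \<Rightarrow> 'a::metric_space) \<times> (real \<Rightarrow> 'a)) set" where
  "ray_equiv = {(\<alpha>, \<beta>). \<alpha> \<in> quasi_geodesic_rays \<and> \<beta> \<in> quasi_geodesic_rays \<and>
     hausdorff_distance (ray_image \<alpha>) (ray_image \<beta>) < \<infinity>}"

definition N_Morse :: "(real \<Rightarrow> real \<Rightarrow> real) \<Rightarrow> 'a::metric_space set \<Rightarrow> bool" where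
  "N_Morse N S \<longleftrightarrow>
     (\<forall>K C q a b. a \<le> b \<and> quasi_geodesic_on K C {a..b} q \<and> q a \<in> S \<and> q b \<in> S \<longrightarrow>
        (\<forall>t\<in>{a..b}. infdist (q t) S \<le> N K C))"

definition Morse :: "'a::metric_space set \<Rightarrow> bool" where
  "Morse S \<longleftrightarrow> (\<exists>N. (\<forall>K\<ge>1. \<forall>C\<ge>0. 0 \<le> N K C) \<and> N_Morse N S)"

definition Morse_boundary :: "(real \<Rightarrow> 'a::metric_space) set set" where
  "Morse_boundary = {\<xi> \<in> quasi_geodesic_rays // ray_equiv. \<exists>\<beta>\<in>\<xi>. Morse (ray_image \<beta>)}"

definition geodesic_reps ::
    "'a::metric_space \<Rightarrow> (real \<Rightarrow> 'a) set \<Rightarrow> (real \<Rightarrow> 'a) set" where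
  "geodesic_reps b \<xi> = {\<beta> \<in> \<xi>. geodesic_ray \<beta> \<and> \<beta> 0 = b}"


section \<open>Contracting sets\<close>

definition sublinear_gauge :: "(real \<Rightarrow> real) \<Rightarrow> bool" where
  "sublinear_gauge \<rho> \<longleftrightarrow> (\<forall>r\<ge>0. 0 \<le> \<rho> r) \<and> mono_on {0..} \<rho> \<and> ((\<lambda>r. \<rho> r / r) \<longlongrightarrow> 0) at_top"

definition closest_points :: "'a::metric_space set \<Rightarrow> 'a \<Rightarrow> 'a set" where
  "closest_points S y = {p \<in> S. \<forall>q\<in>S. dist y p \<le> dist y q}"

definition contracting :: "(real \<Rightarrow> real) \<Rightarrow> 'a::metric_space set \<Rightarrow> bool" where
  "contracting \<rho> S \<longleftrightarrow> closed S \<and>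
     (\<forall>x y. x \<notin> S \<and> y \<notin> S \<and> dist x y < infdist y S \<longrightarrow>
        diameter (closest_points S x \<union> closest_points S y) \<le> \<rho> (infdist y S))"

definition kappa :: "(real \<Rightarrow> real) \<Rightarrow> real \<Rightarrow> real \<Rightarrow> real" where
  "kappa \<rho> K C =
     Max {3 * K\<^sup>2, 3 * C, 1 + Inf {R. 0 \<le> R \<and> (\<forall>r\<ge>R. 3 * K\<^sup>2 * \<rho> r \<le> r)}}"


section \<open>The topologies\<close>

text \<open>
  The auxiliary choices: \<open>\<rho> \<xi>\<close> and \<open>\<gamma> \<xi>\<close> are the contraction gauge and the geodesic
  representative chosen for the boundary point \<open>\<xi>\<close>, with respect to the base point \<open>b\<close>.
\<close>
definition admissible_choice ::
    "'a::metric_space \<Rightarrow> ((real \<Rightarrow> 'a) set \<Rightarrow> real \<Rightarrow> real) \<Rightarrow> ((real \<Rightarrow> 'a) set \<Rightarrow> real \<Rightarrow> 'a) \<Rightarrow> bool"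
  where
  "admissible_choice b \<rho> \<gamma> \<longleftrightarrow> (\<forall>\<xi>\<in>Morse_boundary.
     sublinear_gauge (\<rho> \<xi>) \<and> (\<forall>\<beta>\<in>geodesic_reps b \<xi>. contracting (\<rho> \<xi>) (ray_image \<beta>)) \<and>
     \<gamma> \<xi> \<in> geodesic_reps b \<xi>)"

definition fellow_travels ::
    "'a::metric_space \<Rightarrow> (real \<Rightarrow> real) \<Rightarrow> (real \<Rightarrow> 'a) \<Rightarrow> real \<Rightarrow> real \<Rightarrow> real \<Rightarrow> (real \<Rightarrow> 'a) \<Rightarrow> bool"
  where
  "fellow_travels b \<rho> \<gamma> R K C \<beta> \<longleftrightarrow>
     (\<exists>p\<in>ray_image \<beta>. \<exists>q\<in>ray_image \<gamma> - ball b R. dist p q \<le> kappa \<rho> K C)"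

text \<open>
  A ray is a \<open>(K, C)\<close>-quasi-geodesic for many pairs \<open>(K, C)\<close>; the condition is imposed for
  each of them.
\<close>
definition FQ_nbhd ::
    "'a::metric_space \<Rightarrow> (real \<Rightarrow> real) \<Rightarrow> (real \<Rightarrow> 'a) \<Rightarrow> real \<Rightarrow> (real \<Rightarrow> 'a) set set" where
  "FQ_nbhd b \<rho> \<gamma> R = {\<eta> \<in> Morse_boundary.
     \<forall>K C. \<forall>\<beta>\<in>\<eta>. quasi_geodesic_on K C {0..} \<beta> \<and> \<beta> 0 = b \<longrightarrow> fellow_travels b \<rho> \<gamma> R K C \<beta>}"

definition FG_nbhd ::
    "'a::metric_space \<Rightarrow> (real \<Rightarrow> real) \<Rightarrow> (real \<Rightarrow> 'a) \<Rightarrow> real \<Rightarrow> (real \<Rightarrow> 'a) set set" where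
  "FG_nbhd b \<rho> \<gamma> R = {\<eta> \<in> Morse_boundary.
     \<forall>\<beta>\<in>geodesic_reps b \<eta>. fellow_travels b \<rho> \<gamma> R 1 0 \<beta>}"

definition FQ ::
    "'a::metric_space \<Rightarrow> ((real \<Rightarrow> 'a) set \<Rightarrow> real \<Rightarrow> real) \<Rightarrow> ((real \<Rightarrow> 'a) set \<Rightarrow> real \<Rightarrow> 'a) \<Rightarrow>
      (real \<Rightarrow> 'a) set topology" where
  "FQ b \<rho> \<gamma> = topology (\<lambda>U. U \<subseteq> Morse_boundary \<and>
     (\<forall>\<xi>\<in>U. \<exists>R>0. FQ_nbhd b (\<rho> \<xi>) (\<gamma> \<xi>) R \<subseteq> U))"

definition FG ::
    "'a::metric_space \<Rightarrow> ((real \<Rightarrow> 'a) set \<Rightarrow> real \<Rightarrow> real) \<Rightarrow> ((real \<Rightarrow> 'a) set \<Rightarrow> real \<Rightarrow> 'a) \<Rightarrow>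
      (real \<Rightarrow> 'a) set topology" where
  "FG b \<rho> \<gamma> = topology (\<lambda>V. V \<subseteq> Morse_boundary \<and>
     (\<forall>\<xi>\<in>V. \<exists>R>0. FG_nbhd b (\<rho> \<xi>) (\<gamma> \<xi>) R \<subseteq> V))"

text \<open>
  Both families of open sets are topologies for arbitrary \<open>\<rho>\<close> and \<open>\<gamma>\<close>, so \<open>topology\<close>
  is not applied outside its domain.
\<close>
lemma istopology_nbhds:
  assumes mono: "\<And>\<xi> R R'. R \<le> R' \<Longrightarrow> B \<xi> R' \<subseteq> B \<xi> R"
  shows "istopology (\<lambda>U. U \<subseteq> X \<and> (\<forall>\<xi>\<in>U. \<exists>R>0::real. B \<xi> R \<subseteq> U))"
  unfolding istopology_def
proof (intro conjI allI impI)
  fix S T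
  assume S: "S \<subseteq> X \<and> (\<forall>\<xi>\<in>S. \<exists>R>0. B \<xi> R \<subseteq> S)" and T: "T \<subseteq> X \<and> (\<forall>\<xi>\<in>T. \<exists>R>0. B \<xi> R \<subseteq> T)"
  show "S \<inter> T \<subseteq> X" using S by blast
  show "\<forall>\<xi>\<in>S \<inter> T. \<exists>R>0. B \<xi> R \<subseteq> S \<inter> T"
  proof
    fix \<xi> assume "\<xi> \<in> S \<inter> T"
    then obtain R1 R2 where R: "R1 > 0" "B \<xi> R1 \<subseteq> S" "R2 > 0" "B \<xi> R2 \<subseteq> T"
      using S T by (meson IntD1 IntD2)
    have "B \<xi> (max R1 R2) \<subseteq> B \<xi> R1" "B \<xi> (max R1 R2) \<subseteq> B \<xi> R2"
      by (rule mono, simp)+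
    with R have "B \<xi> (max R1 R2) \<subseteq> S \<inter> T" by blast
    moreover have "max R1 R2 > 0" using R(1) by simp
    ultimately show "\<exists>R>0. B \<xi> R \<subseteq> S \<inter> T" by blast
  qed
next
  fix \<K>
  assume K: "\<forall>S\<in>\<K>. S \<subseteq> X \<and> (\<forall>\<xi>\<in>S. \<exists>R>0. B \<xi> R \<subseteq> S)"
  show "\<Union>\<K> \<subseteq> X" using K by blast
  show "\<forall>\<xi>\<in>\<Union>\<K>. \<exists>R>0. B \<xi> R \<subseteq> \<Union>\<K>"
  proof
    fix \<xi> assume "\<xi> \<in> \<Union>\<K>"
    then obtain S where S: "S \<in> \<K>" "\<xi> \<in> S" by blast
    with K obtain R where "R > 0" "B \<xi> R \<subseteq> S" by meson
    with S(1) show "\<exists>R>0. B \<xi> R \<subseteq> \<Union>\<K>" by blast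
  qed
qed

lemma fellow_travels_mono:
  "R \<le> R' \<Longrightarrow> fellow_travels b \<rho> \<gamma> R' K C \<beta> \<Longrightarrow> fellow_travels b \<rho> \<gamma> R K C \<beta>"
  unfolding fellow_travels_def using subset_ball[of R R' b] by blast

lemma openin_FQ:
  "openin (FQ b \<rho> \<gamma>) U \<longleftrightarrow> U \<subseteq> Morse_boundary \<and>
     (\<forall>\<xi>\<in>U. \<exists>R>0. FQ_nbhd b (\<rho> \<xi>) (\<gamma> \<xi>) R \<subseteq> U)"
proof -
  have "FQ_nbhd b (\<rho> \<xi>) (\<gamma> \<xi>) R' \<subseteq> FQ_nbhd b (\<rho> \<xi>) (\<gamma> \<xi>) R" if "R \<le> R'" for \<xi> R R'
    unfolding FQ_nbhd_def using fellow_travels_mono[OF that] by blast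
  from istopology_nbhds[of "\<lambda>\<xi>. FQ_nbhd b (\<rho> \<xi>) (\<gamma> \<xi>)", OF this]
  show ?thesis unfolding FQ_def by (simp only: topology_inverse')
qed

lemma openin_FG:
  "openin (FG b \<rho> \<gamma>) V \<longleftrightarrow> V \<subseteq> Morse_boundary \<and>
     (\<forall>\<xi>\<in>V. \<exists>R>0. FG_nbhd b (\<rho> \<xi>) (\<gamma> \<xi>) R \<subseteq> V)"
proof -
  have "FG_nbhd b (\<rho> \<xi>) (\<gamma> \<xi>) R' \<subseteq> FG_nbhd b (\<rho> \<xi>) (\<gamma> \<xi>) R" if "R \<le> R'" for \<xi> R R'
    unfolding FG_nbhd_def using fellow_travels_mono[OF that] by blast
  from istopology_nbhds[of "\<lambda>\<xi>. FG_nbhd b (\<rho> \<xi>) (\<gamma> \<xi>)", OF this]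
  show ?thesis unfolding FG_def by (simp only: topology_inverse')
qed

end

theory Submission
  imports Defs
begin

text \<open>
  It suffices that around every boundary point each neighbourhood for the base point \<open>b\<close> contains a
  neighbourhood for \<open>b'\<close>. So let a ray \<open>\<beta>\<close> from \<open>b\<close> represent a point \<open>\<eta>\<close> that is close to \<open>\<xi>\<close> as seen
  from \<open>b'\<close>, very far out. A representative \<open>\<beta>'\<close> of \<open>\<eta>\<close> from \<open>b'\<close>, staying near \<open>\<beta>\<close>, comes close to
  the chosen ray \<open>\<gamma>'\<close> of \<open>\<xi>\<close> far away from \<open>b'\<close>. As \<open>\<gamma>\<close> and \<open>\<gamma>'\<close> have finite Hausdorff distance, \<open>\<beta>\<close>
  has a far point at bounded distance from \<open>\<gamma>\<close>; but this bound, which involves the distance of the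
  base points and that of the two rays, may exceed the constant \<open>kappa\<close> that fellow-travelling asks for.

  Contraction closes this gap (\<open>fellow_travels_if_far_point_close\<close>). While a \<open>(K, C)\<close>-quasi-geodesic is
  farther than \<open>kappa\<close> from \<open>\<gamma>\<close>, its closest point projection to \<open>\<gamma>\<close> moves with speed at most
  \<open>1 / (2 * K)\<close> (\<open>projection_drift\<close>), which is half the least speed of the quasi-geodesic itself. An
  excursion out of the \<open>kappa\<close>-neighbourhood whose end points are at bounded distance from \<open>\<gamma>\<close> is
  therefore of bounded size (\<open>excursion_bound\<close>). Hence, if \<open>\<beta>\<close> has a sufficiently far point near \<open>\<gamma>\<close>,
  then before reaching it \<open>\<beta>\<close> visits the \<open>kappa\<close>-neighbourhood at a point that projects outside \<open>ball b R\<close>.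

  For \<open>FQ\<close> the ray \<open>\<beta>'\<close> is \<open>\<beta>\<close> with its initial value replaced by \<open>b'\<close>, at the cost of enlarging \<open>C\<close> by
  the distance of the base points. One radius for \<open>b'\<close> must serve all \<open>K\<close> and \<open>C\<close>: when
  \<open>kappa\<close> is at least \<open>R\<close>, the starting point of \<open>\<beta>\<close> already fellow-travels with \<open>\<gamma>\<close> for distance \<open>R\<close>, and
  in the remaining case \<open>K\<close> and \<open>C\<close> are below \<open>R\<close>. For \<open>FG\<close> the replacement must be a geodesic ray; in a
  CAT(0) space asymptotic geodesic rays stay as close as their starting points
  (\<open>CAT0_asymptotic_rays\<close>), a bound that is uniform in \<open>\<eta>\<close>.
\<close>

section \<open>Closest points and the constant kappa\<close>

lemma closest_points_nonempty:
  fixes S :: "'a::metric_space set"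
  assumes "proper_space TYPE('a)" "closed S" "S \<noteq> {}"
  shows "closest_points S y \<noteq> {}"
proof -
  obtain z where z: "z \<in> S" using assms(3) by blast
  define B where "B = cball y (dist y z) \<inter> S"
  have "compact B"
    using assms(1,2) unfolding B_def proper_space_def by (intro compact_Int_closed) auto
  moreover have zB: "z \<in> B" using z by (auto simp: B_def)
  moreover have "continuous_on B (dist y)" by (intro continuous_intros)
  ultimately obtain p where p: "p \<in> B" "\<forall>q\<in>B. dist y p \<le> dist y q"
    using continuous_attains_inf[of B "dist y"] by blast
  have "dist y p \<le> dist y q" if "q \<in> S" for q
  proof (cases "q \<in> B")
    case False
    then have "dist y z < dist y q" using that by (auto simp: B_def)
    then show ?thesis using p(2) zB by force
  qed (use p in auto)
  then show ?thesis using p(1) by (auto simp: closest_points_def B_def)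
qed

lemma dist_closest_point:
  assumes "p \<in> closest_points S y"
  shows "dist y p = infdist y S"
proof (rule antisym)
  have ne: "S \<noteq> {}" and p: "\<And>q. q \<in> S \<Longrightarrow> dist y p \<le> dist y q"
    using assms by (auto simp: closest_points_def)
  show "dist y p \<le> infdist y S"
    unfolding infdist_notempty[OF ne] by (intro cINF_greatest ne p)
  show "infdist y S \<le> dist y p"
    using assms by (auto simp: closest_points_def intro: infdist_le)
qed

lemma contracting_projection_bound:
  assumes "contracting \<rho> S" "x \<notin> S" "y \<notin> S" "dist x y < infdist y S"
    and "p \<in> closest_points S x" "q \<in> closest_points S y"
  shows "dist p q \<le> \<rho> (infdist y S)"
proof -
  have "bounded (closest_points S z)" for z
    unfolding bounded_def using dist_closest_point[of _ S z] by (metis order_refl)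
  then have "dist p q \<le> diameter (closest_points S x \<union> closest_points S y)"
    using assms(5,6) by (intro diameter_bounded_bound) auto
  also have "\<dots> \<le> \<rho> (infdist y S)" using assms(1-4) unfolding contracting_def by blast
  finally show ?thesis .
qed

lemma kappa_lower_bounds:
  shows "3 * K\<^sup>2 \<le> kappa \<rho> K C" "3 * C \<le> kappa \<rho> K C"
    and "1 + Inf {R. 0 \<le> R \<and> (\<forall>r\<ge>R. 3 * K\<^sup>2 * \<rho> r \<le> r)} \<le> kappa \<rho> K C"
  unfolding kappa_def by (rule Max_ge; simp)+

lemma kappa_threshold_nonempty:
  assumes "sublinear_gauge \<rho>"
  shows "{R. 0 \<le> R \<and> (\<forall>r\<ge>R. 3 * K\<^sup>2 * \<rho> r \<le> r)} \<noteq> {}"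
proof -
  define e where "e = 1 / (3 * K\<^sup>2 + 1)"
  have "3 * K\<^sup>2 + 1 > 0" by (simp add: add_nonneg_pos)
  then have e: "e > 0" "3 * K\<^sup>2 * e \<le> 1" by (auto simp: e_def divide_le_eq)
  have "((\<lambda>r. \<rho> r / r) \<longlongrightarrow> 0) at_top" using assms by (simp add: sublinear_gauge_def)
  then have "eventually (\<lambda>r. \<rho> r / r < e) at_top" using e(1) by (rule order_tendstoD)
  then obtain N where N: "\<And>r. r \<ge> N \<Longrightarrow> \<rho> r / r < e"
    by (auto simp: eventually_at_top_linorder)
  have "3 * K\<^sup>2 * \<rho> r \<le> r" if r: "r \<ge> max N 1" for r
  proof -
    have "\<rho> r \<le> e * r" using N[of r] r by (simp add: field_simps)
    then have "3 * K\<^sup>2 * \<rho> r \<le> 3 * K\<^sup>2 * (e * r)" by (intro mult_left_mono) auto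
    also have "\<dots> = (3 * K\<^sup>2 * e) * r" by simp
    also have "\<dots> \<le> 1 * r" using r e(2) by (intro mult_right_mono) auto
    finally show ?thesis by simp
  qed
  then show ?thesis by (intro ex_in_conv[THEN iffD1] exI[of _ "max N 1"]) auto
qed

text \<open>
  The summand \<open>1\<close> in \<open>kappa\<close> puts \<open>r\<close> strictly above the infimum, which need not be attained.
\<close>

lemma gauge_beyond_kappa:
  assumes "sublinear_gauge \<rho>" "kappa \<rho> K C \<le> r"
  shows "3 * K\<^sup>2 * \<rho> r \<le> r"
proof -
  let ?X = "{R. 0 \<le> R \<and> (\<forall>r\<ge>R. 3 * K\<^sup>2 * \<rho> r \<le> r)}"
  have "Inf ?X < r" using kappa_lower_bounds(3)[of K \<rho> C] assms(2) by linarith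
  then obtain R where "R \<in> ?X" "R < r"
    using cInf_lessD[OF kappa_threshold_nonempty[OF assms(1), of K]] by blast
  then show ?thesis by simp
qed

lemma kappa_mono:
  assumes "sublinear_gauge \<rho>" "0 \<le> K" "K \<le> K'" "C \<le> C'"
  shows "kappa \<rho> K C \<le> kappa \<rho> K' C'"
proof -
  let ?X = "\<lambda>K. {R. 0 \<le> R \<and> (\<forall>r\<ge>R. 3 * K\<^sup>2 * \<rho> r \<le> r)}"
  have K: "3 * K\<^sup>2 \<le> 3 * K'\<^sup>2" using assms by (simp add: power_mono)
  have "?X K' \<subseteq> ?X K"
  proof safe
    fix R r :: real
    assume "0 \<le> R" "\<forall>r\<ge>R. 3 * K'\<^sup>2 * \<rho> r \<le> r" "R \<le> r"
    moreover from this have "0 \<le> \<rho> r" using assms(1) by (simp add: sublinear_gauge_def)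
    ultimately show "3 * K\<^sup>2 * \<rho> r \<le> r"
      using mult_right_mono[OF K, of "\<rho> r"] by force
  qed
  then have "Inf (?X K) \<le> Inf (?X K')"
    by (intro cInf_superset_mono kappa_threshold_nonempty assms(1) bdd_belowI[of _ 0]) auto
  then show ?thesis
    using K assms(4) kappa_lower_bounds[of K' \<rho> C'] kappa_lower_bounds(2)[of C' \<rho> K']
    unfolding kappa_def[of \<rho> K C] by (auto simp: Max_le_iff)
qed


section \<open>Quasi-geodesics far from a contracting set\<close>

text \<open>
  Put \<open>d\<close> for the distance to \<open>S\<close> at the current time. In a time step of length \<open>2 * d / (3 * K)\<close> the
  curve moves by less than \<open>d\<close>, because \<open>d\<close> exceeds \<open>3 * C\<close>; so the projection moves by at most
  \<open>\<rho> d\<close>, which is at most \<open>d / (3 * K\<^sup>2)\<close>, that is, the length of the step divided by \<open>2 * K\<close>. Stepping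
  in time rather than along a path accommodates the jumps of \<open>q\<close>.
\<close>

lemma projection_drift:
  fixes S :: "'a::metric_space set"
  assumes proper: "proper_space TYPE('a)" and S: "S \<noteq> {}" "contracting \<rho> S" "sublinear_gauge \<rho>"
    and qg: "quasi_geodesic_on K C {a..T} q" and "a \<le> T"
    and far: "\<And>t. t \<in> {a..T} \<Longrightarrow> kappa \<rho> K C < infdist (q t) S"
    and p: "p \<in> closest_points S (q a)" and p': "p' \<in> closest_points S (q T)"
  shows "dist p p' \<le> (T - a) / (2 * K) + infdist (q T) S + C"
proof -
  have K: "1 \<le> K" and C: "0 \<le> C"
    and up: "\<And>s t. s \<in> {a..T} \<Longrightarrow> t \<in> {a..T} \<Longrightarrow> dist (q s) (q t) \<le> K * \<bar>s - t\<bar> + C"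
    using qg by (auto simp: quasi_geodesic_on_def)
  have K2: "1 \<le> K\<^sup>2" using K by simp
  have closedS: "closed S" using S(2) by (simp add: contracting_def)
  let ?d = "\<lambda>t. infdist (q t) S"
  have far': "?d t > 3 * C" "?d t > 3" if "t \<in> {a..T}" for t
    using far[OF that] kappa_lower_bounds(1)[of K \<rho> C] kappa_lower_bounds(2)[of C \<rho> K] K2
    by auto
  have step: "dist u v \<le> ?d s / (3 * K\<^sup>2)"
    if "a \<le> s" "s \<le> t" "t \<le> T" "t - s \<le> 2 * ?d s / (3 * K)"
      "u \<in> closest_points S (q s)" "v \<in> closest_points S (q t)" for s t u v
  proof -
    have st: "s \<in> {a..T}" "t \<in> {a..T}" using that by auto
    have "K * (t - s) \<le> 2 * ?d s / 3" using that(4) K by (simp add: field_simps)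
    then have "dist (q t) (q s) < ?d s" using up[OF st(2,1)] far'(1)[OF st(1)] that(2) by simp
    moreover have "q s \<notin> S" "q t \<notin> S" using far'(2)[OF st(1)] far'(2)[OF st(2)] by auto
    ultimately have "dist v u \<le> \<rho> (?d s)"
      using S(2) that(5,6) by (intro contracting_projection_bound) auto
    moreover have "\<rho> (?d s) \<le> ?d s / (3 * K\<^sup>2)"
      using gauge_beyond_kappa[OF S(3) less_imp_le[OF far[OF st(1)]]] K
      by (simp add: field_simps)
    ultimately show ?thesis by (simp add: dist_commute)
  qed
  \<comment> \<open>As distances to \<open>S\<close> exceed \<open>3\<close>, every time step is longer than \<open>\<delta>\<close>, so finitely many suffice.\<close>
  define \<delta> where "\<delta> = 2 / K"
  have \<delta>: "\<delta> > 0" using K by (simp add: \<delta>_def)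
  have drift: "dist u p' \<le> (T - s) / (2 * K) + ?d T + C"
    if "a \<le> s" "s \<le> T" "T - s \<le> real n * \<delta>" "u \<in> closest_points S (q s)" for s u n
    using that
  proof (induction n arbitrary: s u)
    case 0
    then have "s = T" by simp
    with step[of s T u p'] 0 p' have "dist u p' \<le> ?d T / (3 * K\<^sup>2)"
      using far'(2)[of T] K \<open>a \<le> T\<close> by simp
    also have "\<dots> \<le> ?d T / 1" using K2 far'(2)[of T] \<open>a \<le> T\<close> by (intro divide_left_mono) auto
    also have "\<dots> = ?d T" by simp
    finally show ?case using \<open>s = T\<close> C by simp
  next
    case (Suc n)
    have s: "s \<in> {a..T}" using Suc.prems by auto
    define \<tau> where "\<tau> = 2 * ?d s / (3 * K)"
    have \<tau>: "\<tau> > \<delta>" using far'(2)[OF s] K by (simp add: \<tau>_def \<delta>_def field_simps)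
    show ?case
    proof (cases "s + \<tau> \<le> T")
      case True
      obtain v where v: "v \<in> closest_points S (q (s + \<tau>))"
        using closest_points_nonempty[OF proper closedS S(1)] by blast
      have "dist u v \<le> ?d s / (3 * K\<^sup>2)"
        using Suc.prems v True \<tau> \<delta> by (intro step[of s "s + \<tau>"]) (auto simp: \<tau>_def)
      also have "\<dots> = \<tau> / (2 * K)" by (simp add: \<tau>_def power2_eq_square)
      finally have "dist u v \<le> \<tau> / (2 * K)" .
      moreover have "dist v p' \<le> (T - (s + \<tau>)) / (2 * K) + ?d T + C"
        using Suc.prems v True \<tau> \<delta> by (intro Suc.IH) (auto simp: algebra_simps)
      moreover have "dist u p' \<le> dist u v + dist v p'" by (rule dist_triangle)
      ultimately show ?thesis by (simp add: diff_divide_distrib add_divide_distrib)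
    next
      \<comment> \<open>The last, incomplete step is paid for by the distance of the end point to \<open>S\<close>.\<close>
      case False
      have Ts: "K * (T - s) \<le> 2 * ?d s / 3"
        using False K by (simp add: \<tau>_def field_simps)
      have "?d s \<le> ?d T + dist (q s) (q T)" by (rule infdist_triangle)
      also have "\<dots> \<le> ?d T + (K * (T - s) + C)"
        using up[OF s, of T] Suc.prems by simp
      finally have "?d s \<le> 3 * (?d T + C)" using Ts by simp
      moreover have "dist u p' \<le> ?d s / (3 * K\<^sup>2)"
        using Suc.prems p' False by (intro step[of s T]) (auto simp: \<tau>_def)
      moreover have "?d s / (3 * K\<^sup>2) \<le> ?d s / 3"
        using K2 far'(2)[OF s] by (intro divide_left_mono) auto
      moreover have "0 \<le> (T - s) / (2 * K)" using Suc.prems K by simp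
      ultimately show ?thesis by simp
    qed
  qed
  obtain n where "T - a \<le> real n * \<delta>" using reals_Archimedean3[OF \<delta>] less_imp_le by metis
  then show ?thesis using drift[of a n p] \<open>a \<le> T\<close> p by simp
qed

text \<open>
  The distance of the end points is at least \<open>(T - a) / K - C\<close> by quasi-geodesicity, and through the
  projections it is at most \<open>(T - a) / (2 * K)\<close> plus terms that depend only on the distances of the
  end points to \<open>S\<close>. Comparing the two bounds \<open>T - a\<close>, and with it the distance.
\<close>

lemma excursion_bound:
  fixes S :: "'a::metric_space set"
  assumes proper: "proper_space TYPE('a)" and S: "S \<noteq> {}" "contracting \<rho> S" "sublinear_gauge \<rho>"
    and qg: "quasi_geodesic_on K C {a..T} q" and aT: "a \<le> T"
    and far: "\<And>t. t \<in> {a..T} \<Longrightarrow> kappa \<rho> K C < infdist (q t) S"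
  shows "dist (q a) (q T) \<le> 2 * infdist (q a) S + 4 * infdist (q T) S + 3 * C"
proof -
  have closedS: "closed S" using S(2) by (simp add: contracting_def)
  obtain p p' where p: "p \<in> closest_points S (q a)" "p' \<in> closest_points S (q T)"
    using closest_points_nonempty[OF proper closedS S(1)] by blast
  have "(T - a) / K - C \<le> dist (q a) (q T)"
    using qg aT by (force simp: quasi_geodesic_on_def)
  moreover have "dist (q a) (q T) \<le> dist (q a) p + dist p p' + dist p' (q T)"
    by metric
  moreover have "dist p p' \<le> (T - a) / (2 * K) + infdist (q T) S + C"
    using projection_drift[OF assms p] by simp
  moreover have "(T - a) / K = 2 * ((T - a) / (2 * K))"
    unfolding times_divide_eq_right by (rule mult_divide_mult_cancel_left[symmetric]) simp
  ultimately show ?thesis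
    using dist_closest_point[OF p(1)] dist_closest_point[OF p(2)]
    by (simp add: dist_commute)
qed

text \<open>
  Otherwise every point of \<open>\<beta>\<close> in the \<open>kappa\<close>-neighbourhood of \<open>\<gamma>\<close> projects into \<open>ball b R\<close> and so lies
  within \<open>R + kappa\<close> of \<open>b\<close>. Soon after the last visits before time \<open>T\<close>, \<open>\<beta>\<close> starts an excursion that
  ends within \<open>J\<close> of \<open>\<gamma>\<close>, and \<open>excursion_bound\<close> contradicts the distance of \<open>\<beta> T\<close> from \<open>b\<close>. Since
  \<open>kappa\<close> dominates \<open>3 * K\<close> and \<open>3 * C\<close>, it absorbs all error terms.
\<close>

lemma fellow_travels_if_far_point_close:
  fixes \<gamma> :: "real \<Rightarrow> 'a::metric_space"
  assumes proper: "proper_space TYPE('a)"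
    and S: "contracting \<rho> (ray_image \<gamma>)" "sublinear_gauge \<rho>" "\<gamma> 0 = b"
    and qg: "quasi_geodesic_on K C {0..} \<beta>" and \<beta>0: "\<beta> 0 = b" and T: "0 \<le> T"
    and close: "infdist (\<beta> T) (ray_image \<gamma>) \<le> J"
    and far: "R + 6 * kappa \<rho> K C + 4 * J < dist b (\<beta> T)"
  shows "fellow_travels b \<rho> \<gamma> R K C \<beta>"
proof (rule ccontr)
  assume no: "\<not> fellow_travels b \<rho> \<gamma> R K C \<beta>"
  define S where "S = ray_image \<gamma>"
  define \<kappa> where "\<kappa> = kappa \<rho> K C"
  have bS: "b \<in> S" using S(3) by (auto simp: S_def ray_image_def)
  have K: "1 \<le> K" and C: "0 \<le> C"
    and up: "\<And>s t. s \<ge> 0 \<Longrightarrow> t \<ge> 0 \<Longrightarrow> dist (\<beta> s) (\<beta> t) \<le> K * \<bar>s - t\<bar> + C"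
    using qg by (auto simp: quasi_geodesic_on_def)
  have J: "0 \<le> J" using close infdist_nonneg order_trans by blast
  have "K * 1 \<le> K * K" using K by (intro mult_left_mono) auto
  then have \<kappa>: "3 * K \<le> \<kappa>" "3 * C \<le> \<kappa>"
    using kappa_lower_bounds(1)[of K \<rho> C] kappa_lower_bounds(2)[of C \<rho> K]
    by (auto simp: \<kappa>_def power2_eq_square)
  have near: "dist b (\<beta> t) \<le> R + \<kappa>" if t: "0 \<le> t" "infdist (\<beta> t) S \<le> \<kappa>" for t
  proof -
    obtain p where p: "p \<in> closest_points S (\<beta> t)"
      using closest_points_nonempty[OF proper, of S "\<beta> t"] S(1) bS
      by (auto simp: contracting_def S_def)
    have d: "dist (\<beta> t) p \<le> \<kappa>" using dist_closest_point[OF p] t(2) by simp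
    have "p \<in> ray_image \<gamma>" using p by (simp add: closest_points_def S_def)
    moreover have "\<beta> t \<in> ray_image \<beta>" using t(1) by (auto simp: ray_image_def)
    ultimately have "p \<in> ball b R"
      using no d unfolding fellow_travels_def \<kappa>_def by blast
    then show ?thesis using d dist_triangle[of b "\<beta> t" p] by (simp add: dist_commute)
  qed
  define A where "A = {t \<in> {0..T}. infdist (\<beta> t) S \<le> \<kappa>}"
  have A: "0 \<in> A" "bdd_above A"
    using T \<beta>0 bS \<kappa> C by (auto simp: A_def intro!: bdd_aboveI[of _ T])
  \<comment> \<open>The supremum of the visits to the neighbourhood need not be attained, since \<open>\<beta>\<close> may be
    discontinuous; leaving up to one unit of time costs only \<open>K + C\<close>.\<close>
  obtain s where s: "s \<in> A" "Sup A - 1 < s"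
    using less_cSupD[of A "Sup A - 1"] A by auto
  have s0: "0 \<le> s" "s \<le> T" using s by (auto simp: A_def)
  have ds: "dist b (\<beta> s) \<le> R + \<kappa>" "infdist (\<beta> s) S \<le> \<kappa>"
    using near[of s] s by (auto simp: A_def)
  show False
  proof (cases "s + 1 \<le> T")
    case False
    have "K * \<bar>s - T\<bar> \<le> K * 1" using False s0 K by (intro mult_left_mono) auto
    then have "dist (\<beta> s) (\<beta> T) \<le> K + C" using up[of s T] s0 by simp
    then show False
      using far ds(1) dist_triangle[of b "\<beta> T" "\<beta> s"] \<kappa> K C J unfolding \<kappa>_def[symmetric] by simp
  next
    case True
    have far1: "\<kappa> < infdist (\<beta> t) S" if "t \<in> {s + 1..T}" for t
    proof (rule ccontr)
      assume "\<not> \<kappa> < infdist (\<beta> t) S"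
      then have "t \<in> A" using that s0 by (auto simp: A_def)
      then have "t \<le> Sup A" using A(2) by (rule cSup_upper)
      then show False using that s(2) by simp
    qed
    have "quasi_geodesic_on K C {s + 1..T} \<beta>"
      using qg s0 by (auto simp: quasi_geodesic_on_def)
    then have "dist (\<beta> (s + 1)) (\<beta> T)
        \<le> 2 * infdist (\<beta> (s + 1)) S + 4 * infdist (\<beta> T) S + 3 * C"
      using excursion_bound[OF proper _ S(1,2), of K C "s + 1" T \<beta>] bS far1 True
      by (auto simp: S_def \<kappa>_def)
    moreover have d1: "dist (\<beta> s) (\<beta> (s + 1)) \<le> K + C" using up[of s "s + 1"] s0 by simp
    moreover have "infdist (\<beta> (s + 1)) S \<le> \<kappa> + (K + C)"
      using infdist_triangle[of "\<beta> (s + 1)" S "\<beta> s"] d1 ds(2) by (simp add: dist_commute)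
    moreover have "dist b (\<beta> T) \<le> dist b (\<beta> s) + dist (\<beta> s) (\<beta> (s + 1)) + dist (\<beta> (s + 1)) (\<beta> T)"
      by metric
    ultimately show False
      using far ds(1) close \<kappa> K C J unfolding \<kappa>_def[symmetric] S_def[symmetric] by simp
  qed
qed


section \<open>Equivalence classes of rays\<close>

lemma hausdorff_distance_finite_iff:
  "hausdorff_distance A B < \<infinity> \<longleftrightarrow>
     (\<exists>r\<ge>0. (\<forall>a\<in>A. \<exists>b\<in>B. dist a b \<le> r) \<and> (\<forall>b\<in>B. \<exists>a\<in>A. dist a b \<le> r))"
proof
  assume "hausdorff_distance A B < \<infinity>"
  then show "\<exists>r\<ge>0. (\<forall>a\<in>A. \<exists>b\<in>B. dist a b \<le> r) \<and> (\<forall>b\<in>B. \<exists>a\<in>A. dist a b \<le> r)"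
    unfolding hausdorff_distance_def Inf_less_iff by blast
next
  assume "\<exists>r\<ge>0. (\<forall>a\<in>A. \<exists>b\<in>B. dist a b \<le> r) \<and> (\<forall>b\<in>B. \<exists>a\<in>A. dist a b \<le> r)"
  then obtain r where "0 \<le> r \<and> (\<forall>a\<in>A. \<exists>b\<in>B. dist a b \<le> r) \<and> (\<forall>b\<in>B. \<exists>a\<in>A. dist a b \<le> r)"
    by blast
  then have "hausdorff_distance A B \<le> ereal r"
    unfolding hausdorff_distance_def by (intro Inf_lower) blast
  then show "hausdorff_distance A B < \<infinity>" by (rule le_less_trans) simp
qed

lemma Morse_boundary_reps_close:
  assumes "\<xi> \<in> Morse_boundary" "\<alpha> \<in> \<xi>" "\<beta> \<in> \<xi>"
  obtains r where "0 \<le> r" "\<And>a. a \<in> ray_image \<alpha> \<Longrightarrow> \<exists>b\<in>ray_image \<beta>. dist a b \<le> r"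
proof -
  obtain x where "\<xi> = ray_equiv `` {x}"
    using assms(1) by (auto simp: Morse_boundary_def quotient_def)
  then have "hausdorff_distance (ray_image x) (ray_image \<alpha>) < \<infinity>"
    "hausdorff_distance (ray_image x) (ray_image \<beta>) < \<infinity>"
    using assms(2,3) by (auto simp: ray_equiv_def)
  then obtain r s where r: "0 \<le> r" "\<forall>b\<in>ray_image \<alpha>. \<exists>a\<in>ray_image x. dist a b \<le> r"
    and s: "0 \<le> s" "\<forall>a\<in>ray_image x. \<exists>b\<in>ray_image \<beta>. dist a b \<le> s"
    unfolding hausdorff_distance_finite_iff by blast
  show ?thesis
  proof (rule that[of "r + s"])
    fix a assume "a \<in> ray_image \<alpha>"
    then obtain c b where "c \<in> ray_image x" "dist c a \<le> r" "b \<in> ray_image \<beta>" "dist c b \<le> s"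
      using r s by blast
    then show "\<exists>b\<in>ray_image \<beta>. dist a b \<le> r + s"
      using dist_triangle[of a b c] by (intro bexI[of _ b]) (auto simp: dist_commute)
  qed (use r s in simp)
qed

text \<open>
  This puts the representatives with changed base point back into the same boundary point.
\<close>

lemma Morse_boundary_change_rep:
  assumes "\<xi> \<in> Morse_boundary" "\<alpha> \<in> \<xi>" "\<beta> \<in> quasi_geodesic_rays"
    and D: "\<And>t. t \<ge> 0 \<Longrightarrow> dist (\<alpha> t) (\<beta> t) \<le> D"
  shows "\<beta> \<in> \<xi>"
proof -
  obtain x where x: "\<xi> = ray_equiv `` {x}"
    using assms(1) by (auto simp: Morse_boundary_def quotient_def)
  then have "hausdorff_distance (ray_image x) (ray_image \<alpha>) < \<infinity>"
    and xq: "x \<in> quasi_geodesic_rays"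
    using assms(2) by (auto simp: ray_equiv_def)
  then obtain r where r: "0 \<le> r" "\<forall>a\<in>ray_image x. \<exists>b\<in>ray_image \<alpha>. dist a b \<le> r"
      "\<forall>b\<in>ray_image \<alpha>. \<exists>a\<in>ray_image x. dist a b \<le> r"
    unfolding hausdorff_distance_finite_iff by blast
  have "0 \<le> D" using D[of 0] zero_le_dist[of "\<alpha> 0" "\<beta> 0"] by linarith
  moreover have "\<exists>b\<in>ray_image \<beta>. dist a b \<le> r + D" if "a \<in> ray_image x" for a
  proof -
    obtain c where "c \<in> ray_image \<alpha>" "dist a c \<le> r" using r(2) \<open>a \<in> ray_image x\<close> by blast
    then obtain t where "t \<ge> 0" "dist a (\<alpha> t) \<le> r" by (auto simp: ray_image_def)
    then have "dist a (\<beta> t) \<le> r + D" "\<beta> t \<in> ray_image \<beta>"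
      using D[of t] dist_triangle[of a "\<beta> t" "\<alpha> t"] by (auto simp: ray_image_def)
    then show ?thesis by blast
  qed
  moreover have "\<exists>a\<in>ray_image x. dist a b \<le> r + D" if "b \<in> ray_image \<beta>" for b
  proof -
    obtain t where t: "t \<ge> 0" "b = \<beta> t"
      using \<open>b \<in> ray_image \<beta>\<close> by (auto simp: ray_image_def)
    then have "\<alpha> t \<in> ray_image \<alpha>" by (simp add: ray_image_def)
    then obtain a where a: "a \<in> ray_image x" "dist a (\<alpha> t) \<le> r" using r(3) by blast
    then have "dist a b \<le> r + D" using D[of t] t dist_triangle[of a "\<beta> t" "\<alpha> t"] by simp
    then show ?thesis using a(1) by blast
  qed
  ultimately have "hausdorff_distance (ray_image x) (ray_image \<beta>) < \<infinity>"
    unfolding hausdorff_distance_finite_iff using r(1)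
    by (intro exI[of _ "r + D"] conjI ballI add_nonneg_nonneg)
  then show ?thesis using x xq assms(3) by (auto simp: ray_equiv_def)
qed

text \<open>
  Quasi-geodesics may jump, so the base point can be moved by changing a single value.
\<close>

lemma quasi_geodesic_on_rebase:
  assumes "quasi_geodesic_on K C {0..} \<beta>"
  shows "quasi_geodesic_on K (C + dist (\<beta> 0) b) {0..} (\<beta>(0 := b))"
proof -
  have KC: "1 \<le> K" "0 \<le> C"
    and q: "\<And>s t. s \<ge> 0 \<Longrightarrow> t \<ge> 0 \<Longrightarrow>
      \<bar>s - t\<bar> / K - C \<le> dist (\<beta> s) (\<beta> t) \<and> dist (\<beta> s) (\<beta> t) \<le> K * \<bar>s - t\<bar> + C"
    using assms by (auto simp: quasi_geodesic_on_def)
  have close: "\<bar>dist ((\<beta>(0 := b)) s) ((\<beta>(0 := b)) t) - dist (\<beta> s) (\<beta> t)\<bar> \<le> dist (\<beta> 0) b" for s t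
  proof -
    have "\<bar>dist b y - dist x y\<bar> \<le> dist x b" "\<bar>dist y b - dist y x\<bar> \<le> dist x b" for x y
      by metric+
    then show ?thesis by simp
  qed
  show ?thesis
    unfolding quasi_geodesic_on_def
  proof (intro conjI ballI)
    fix s t :: real assume "s \<in> {0..}" "t \<in> {0..}"
    then have "0 \<le> s" "0 \<le> t" by auto
    with q[OF this] close[of s t]
    show "\<bar>s - t\<bar> / K - (C + dist (\<beta> 0) b) \<le> dist ((\<beta>(0 := b)) s) ((\<beta>(0 := b)) t)"
      "dist ((\<beta>(0 := b)) s) ((\<beta>(0 := b)) t) \<le> K * \<bar>s - t\<bar> + (C + dist (\<beta> 0) b)"
      by linarith+
  qed (use KC in auto)
qed

lemma geodesic_ray_dist_start: "geodesic_ray \<gamma> \<Longrightarrow> 0 \<le> t \<Longrightarrow> dist (\<gamma> 0) (\<gamma> t) = t"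
  by (simp add: geodesic_ray_def)


section \<open>Asymptotic rays in a CAT(0) space\<close>

lemma geodesic_joining_reverse:
  assumes "geodesic_joining g x y"
  shows "geodesic_joining (\<lambda>t. g (dist x y - t)) y x"
  using assms by (auto simp: geodesic_joining_def dist_commute)

text \<open>
  The vertices are \<open>(0, 0)\<close>, \<open>(a, 0)\<close> and \<open>(u, v)\<close>, with \<open>u\<close> from the law of cosines; the triangle
  inequalities give \<open>u\<^sup>2 \<le> c\<^sup>2\<close>, so that the height \<open>v\<close> exists. For \<open>a = 0\<close> that law leaves \<open>u\<close>
  undetermined, and \<open>u = c\<close> serves.
\<close>

lemma comparison_triangle:
  fixes x y z :: "'a::metric_space"
  obtains x' y' z' :: "real^2"
  where "dist x' y' = dist x y" "dist y' z' = dist y z" "dist z' x' = dist z x"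
proof -
  define a b c where "a = dist x y" and "b = dist y z" and "c = dist z x"
  have tri: "a \<le> b + c" "b \<le> a + c" "c \<le> a + b" and nn: "0 \<le> a" "0 \<le> b" "0 \<le> c"
    unfolding a_def b_def c_def by metric+
  define u where "u = (if a = 0 then c else (a\<^sup>2 + c\<^sup>2 - b\<^sup>2) / (2 * a))"
  have u: "2 * a * u = a\<^sup>2 + c\<^sup>2 - b\<^sup>2"
    using tri nn by (auto simp: u_def)
  have "u\<^sup>2 \<le> c\<^sup>2"
  proof (cases "a = 0")
    case False
    have "2 * a * u \<le> 2 * a * c"
    proof -
      have "(a - c)\<^sup>2 \<le> b\<^sup>2" using tri nn by (intro abs_le_square_iff[THEN iffD1]) auto
      then show ?thesis using u by (simp add: power2_diff)
    qed
    moreover have "2 * a * (- c) \<le> 2 * a * u"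
    proof -
      have "b\<^sup>2 \<le> (a + c)\<^sup>2" using tri nn by (intro power_mono) auto
      then show ?thesis using u by (simp add: power2_sum)
    qed
    ultimately have "u \<le> c" "- c \<le> u" using False nn
      by (metis less_eq_real_def mult_le_cancel_left_pos mult_pos_pos zero_less_numeral)+
    then show ?thesis by (intro abs_le_square_iff[THEN iffD1]) auto
  qed (simp add: u_def)
  then have v: "u\<^sup>2 + (sqrt (c\<^sup>2 - u\<^sup>2))\<^sup>2 = c\<^sup>2" by simp
  define v where "v = sqrt (c\<^sup>2 - u\<^sup>2)"
  have D: "dist (vector [p, q] :: real^2) (vector [r, s]) = sqrt ((p - r)\<^sup>2 + (q - s)\<^sup>2)" for p q r s
    by (simp add: dist_vec_def L2_set_def sum_2 dist_real_def)
  have "(a - u)\<^sup>2 + v\<^sup>2 = b\<^sup>2" using v u by (simp add: power2_diff v_def[symmetric])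
  then show ?thesis
    using that[of "vector [0, 0]" "vector [a, 0]" "vector [u, v]"] v nn
    by (simp add: D a_def[symmetric] b_def[symmetric] c_def[symmetric] v_def[symmetric])
qed

text \<open>
  In the Euclidean comparison triangle this is the intercept theorem, with equality.
\<close>

lemma CAT0_proportional_points:
  fixes x y z :: "'a::metric_space"
  assumes cat: "CAT0_space TYPE('a)" and f: "geodesic_joining f x y" and h: "geodesic_joining h x z"
    and l: "0 \<le> l" "l \<le> 1"
  shows "dist (f (l * dist x y)) (h (l * dist x z)) \<le> l * dist y z"
proof -
  define h' where "h' = (\<lambda>t. h (dist x z - t))"
  have h': "geodesic_joining h' z x" unfolding h'_def by (rule geodesic_joining_reverse[OF h])
  obtain g where g: "geodesic_joining g y z"
    using cat unfolding CAT0_space_def geodesic_space_def by blast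
  obtain x' y' z' :: "real^2" where tri:
    "dist x' y' = dist x y" "dist y' z' = dist y z" "dist z' x' = dist z x"
    using comparison_triangle by blast
  define p q where "p = f (l * dist x y)" and "q = h (l * dist x z)"
  define p' q' where "p' = (1 - l) *\<^sub>R x' + l *\<^sub>R y'" and "q' = (1 - l) *\<^sub>R x' + l *\<^sub>R z'"
  have lx: "l * dist x y \<in> {0..dist x y}" "(1 - l) * dist z x \<in> {0..dist z x}"
    using l by (auto simp: mult_left_le_one_le)
  have "p \<in> f ` {0..dist x y}" unfolding p_def using lx by blast
  moreover have "dist x p = l * dist x y"
  proof -
    have "dist (f 0) (f (l * dist x y)) = \<bar>0 - l * dist x y\<bar>"
      using f lx(1) unfolding geodesic_joining_def by auto
    then show ?thesis using f l by (simp add: geodesic_joining_def p_def abs_mult)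
  qed
  moreover have "dist x' p' = l * dist x' y'"
  proof -
    have "x' - p' = l *\<^sub>R (x' - y')" by (simp add: p'_def algebra_simps)
    then show ?thesis using l by (simp add: dist_norm)
  qed
  moreover have "p' \<in> closed_segment x' y'" using l by (auto simp: p'_def closed_segment_def)
  ultimately have P: "(p, p') \<in> comparison_pairs f x y x' y'"
    using tri by (simp add: comparison_pairs_def)
  have qh: "q = h' ((1 - l) * dist z x)"
    by (simp add: q_def h'_def algebra_simps dist_commute)
  then have "q \<in> h' ` {0..dist z x}" using lx by blast
  moreover have "dist z q = (1 - l) * dist z x"
  proof -
    have "dist (h' 0) (h' ((1 - l) * dist z x)) = \<bar>0 - (1 - l) * dist z x\<bar>"
      using h' lx(2) unfolding geodesic_joining_def by auto
    then show ?thesis using h' l by (simp add: geodesic_joining_def qh abs_mult)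
  qed
  moreover have "dist z' q' = (1 - l) * dist z' x'"
  proof -
    have "z' - q' = (1 - l) *\<^sub>R (z' - x')" by (simp add: q'_def algebra_simps)
    then show ?thesis using l by (simp add: dist_norm)
  qed
  moreover have "q' \<in> closed_segment z' x'"
    using l by (subst closed_segment_commute) (auto simp: q'_def closed_segment_def)
  ultimately have Q: "(q, q') \<in> comparison_pairs h' z x z' x'"
    using tri by (simp add: comparison_pairs_def)
  have "dist p q \<le> dist p' q'"
    using cat f g h' tri P Q unfolding CAT0_space_def Let_def by blast
  also have "p' - q' = l *\<^sub>R (y' - z')" by (simp add: p'_def q'_def algebra_simps)
  then have "dist p' q' = l * dist y z" using l tri by (simp add: dist_norm)
  finally show ?thesis by (simp add: p_def q_def)
qed

text \<open>
  Take a distant time \<open>T\<close> and split the quadrilateral with vertices \<open>\<beta> 0\<close>, \<open>\<beta>' 0\<close>, \<open>\<beta>' T\<close>, \<open>\<beta> T\<close> along the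
  diagonal \<open>\<sigma>\<close> from \<open>\<beta>' 0\<close> to \<open>\<beta> T\<close>. Comparing points at proportion \<open>t / T\<close>, the triangle at \<open>\<beta> T\<close>
  contributes at most the distance of the starting points, and the triangle at \<open>\<beta>' 0\<close> at most
  \<open>t / T\<close> times the bounded distance between \<open>\<beta> T\<close> and \<open>\<beta>' T\<close>, which vanishes as \<open>T\<close> grows.
\<close>

lemma CAT0_asymptotic_rays:
  fixes \<beta> \<beta>' :: "real \<Rightarrow> 'a::metric_space"
  assumes cat: "CAT0_space TYPE('a)" and ray: "geodesic_ray \<beta>" "geodesic_ray \<beta>'"
    and H: "\<And>x. x \<in> ray_image \<beta>' \<Longrightarrow> \<exists>y\<in>ray_image \<beta>. dist x y \<le> H"
    and t: "0 \<le> t"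
  shows "dist (\<beta> t) (\<beta>' t) \<le> dist (\<beta> 0) (\<beta>' 0)"
proof (rule field_le_epsilon)
  fix e :: real assume e: "0 < e"
  define D where "D = dist (\<beta> 0) (\<beta>' 0)"
  define E where "E = 2 * H + D"
  have bound: "dist (\<beta> T) (\<beta>' T) \<le> E" if T: "0 \<le> T" for T
  proof -
    obtain s where s: "s \<ge> 0" "dist (\<beta>' T) (\<beta> s) \<le> H"
      using H[of "\<beta>' T"] T by (auto simp: ray_image_def)
    have "dist (\<beta> s) (\<beta> T) = \<bar>s - T\<bar>" using ray(1) s T by (simp add: geodesic_ray_def)
    moreover have "dist (\<beta> 0) (\<beta> s) = s" "dist (\<beta>' 0) (\<beta>' T) = T"
      using ray s T by (auto intro: geodesic_ray_dist_start)
    moreover have "dist (\<beta> 0) (\<beta> s) \<le> D + dist (\<beta>' 0) (\<beta>' T) + dist (\<beta>' T) (\<beta> s)"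
      "dist (\<beta>' 0) (\<beta>' T) \<le> D + dist (\<beta> 0) (\<beta> s) + dist (\<beta>' T) (\<beta> s)"
      unfolding D_def by metric+
    moreover have "dist (\<beta> T) (\<beta>' T) \<le> dist (\<beta> s) (\<beta> T) + dist (\<beta>' T) (\<beta> s)" by metric
    ultimately show ?thesis using s unfolding E_def by linarith
  qed
  have E: "0 \<le> E" using bound[of 0] zero_le_dist[of "\<beta> 0" "\<beta>' 0"] by linarith
  \<comment> \<open>Chosen so that \<open>t / T * E \<le> e\<close>.\<close>
  define T where "T = t + t * E / e + 1"
  have tE: "0 \<le> t * E / e" using t E e by simp
  have T: "0 < T" "t \<le> T" using t tE by (auto simp: T_def)
  have "t * E \<le> e * T" using t e by (simp add: T_def algebra_simps)
  then have small: "t / T * E \<le> e" using T by (simp add: field_simps)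
  define l where "l = t / T"
  have l: "0 \<le> l" "l \<le> 1" "l * T = t" using t T by (auto simp: l_def)
  have dT: "dist (\<beta> 0) (\<beta> T) = T" "dist (\<beta>' 0) (\<beta>' T) = T"
    using ray T by (auto intro: geodesic_ray_dist_start)
  have seg: "geodesic_joining \<beta> (\<beta> 0) (\<beta> T)" "geodesic_joining \<beta>' (\<beta>' 0) (\<beta>' T)"
    using ray by (auto simp: geodesic_joining_def geodesic_ray_def dT)
  define L where "L = dist (\<beta>' 0) (\<beta> T)"
  obtain \<sigma> where \<sigma>: "geodesic_joining \<sigma> (\<beta>' 0) (\<beta> T)"
    using cat unfolding CAT0_space_def geodesic_space_def by blast
  have "dist (\<sigma> (l * L)) (\<beta>' t) \<le> l * dist (\<beta> T) (\<beta>' T)"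
    using CAT0_proportional_points[OF cat \<sigma> seg(2) l(1,2)] l(3) dT by (simp add: L_def)
  also have "\<dots> \<le> l * E" using bound[of T] T l by (intro mult_left_mono) auto
  also have "\<dots> \<le> e" using small by (simp add: l_def)
  finally have 1: "dist (\<sigma> (l * L)) (\<beta>' t) \<le> e" .
  have "dist (\<beta> (T - (1 - l) * T)) (\<sigma> (L - (1 - l) * L)) \<le> (1 - l) * D"
    using CAT0_proportional_points[OF cat geodesic_joining_reverse[OF seg(1)]
        geodesic_joining_reverse[OF \<sigma>], of "1 - l"] l dT
    by (simp add: L_def D_def dist_commute)
  moreover have "T - (1 - l) * T = t" "L - (1 - l) * L = l * L" using l(3) by (auto simp: algebra_simps)
  moreover have "(1 - l) * D \<le> D" using l by (intro mult_left_le_one_le) (auto simp: D_def)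
  ultimately have 2: "dist (\<beta> t) (\<sigma> (l * L)) \<le> D" by simp
  show "dist (\<beta> t) (\<beta>' t) \<le> dist (\<beta> 0) (\<beta>' 0) + e"
    using 1 2 dist_triangle[of "\<beta> t" "\<beta>' t" "\<sigma> (l * L)"] by (simp add: D_def)
qed


section \<open>Independence of the base point\<close>

lemma admissible_choiceD:
  assumes "admissible_choice b \<rho> \<gamma>" "\<xi> \<in> Morse_boundary"
  shows "sublinear_gauge (\<rho> \<xi>)" "contracting (\<rho> \<xi>) (ray_image (\<gamma> \<xi>))"
    and "\<gamma> \<xi> \<in> \<xi>" "geodesic_ray (\<gamma> \<xi>)" "\<gamma> \<xi> 0 = b"
  using assms by (auto simp: admissible_choice_def geodesic_reps_def)

text \<open>
  The radius \<open>R'\<close> has to be chosen before \<open>K\<close> and \<open>C\<close> are known. Only parameters with \<open>kappa\<close> below \<open>R\<close>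
  matter, and these are at most \<open>R\<close>; so the monotonicity of \<open>kappa\<close> bounds all relevant constants.
\<close>

lemma FQ_nbhd_change_base:
  fixes b b' :: "'a::metric_space"
  assumes proper: "proper_space TYPE('a)"
    and adm: "admissible_choice b \<rho> \<gamma>" "admissible_choice b' \<rho>' \<gamma>'"
    and \<xi>: "\<xi> \<in> Morse_boundary" and R: "0 < R"
  shows "\<exists>R'>0. FQ_nbhd b' (\<rho>' \<xi>) (\<gamma>' \<xi>) R' \<subseteq> FQ_nbhd b (\<rho> \<xi>) (\<gamma> \<xi>) R"
proof -
  note a = admissible_choiceD[OF adm(1) \<xi>] and a' = admissible_choiceD[OF adm(2) \<xi>]
  obtain H where H: "0 \<le> H" "\<And>x. x \<in> ray_image (\<gamma>' \<xi>) \<Longrightarrow> \<exists>y\<in>ray_image (\<gamma> \<xi>). dist x y \<le> H"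
    using Morse_boundary_reps_close[OF \<xi> a'(3) a(3)] by blast
  define D where "D = dist b b'"
  define k where "k = kappa (\<rho> \<xi>) R R"
  define k' where "k' = kappa (\<rho>' \<xi>) R (R + D)"
  define R' where "R' = R + 6 * k + 4 * (k' + H) + k' + D + 1"
  have D: "0 \<le> D" by (simp add: D_def)
  have k: "0 \<le> k" "0 \<le> k'"
    using kappa_lower_bounds(2)[of R "\<rho> \<xi>" R] kappa_lower_bounds(2)[of "R + D" "\<rho>' \<xi>" R] R D
    by (auto simp: k_def k'_def)
  have "R' > 0" using R k H D by (simp add: R'_def)
  moreover have "FQ_nbhd b' (\<rho>' \<xi>) (\<gamma>' \<xi>) R' \<subseteq> FQ_nbhd b (\<rho> \<xi>) (\<gamma> \<xi>) R"
  proof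
    fix \<eta> assume \<eta>: "\<eta> \<in> FQ_nbhd b' (\<rho>' \<xi>) (\<gamma>' \<xi>) R'"
    then have \<eta>M: "\<eta> \<in> Morse_boundary" by (simp add: FQ_nbhd_def)
    have "fellow_travels b (\<rho> \<xi>) (\<gamma> \<xi>) R K C \<beta>"
      if \<beta>: "\<beta> \<in> \<eta>" "quasi_geodesic_on K C {0..} \<beta>" "\<beta> 0 = b" for K C \<beta>
    proof (cases "R \<le> kappa (\<rho> \<xi>) K C")
      case True
      have "dist b (\<gamma> \<xi> R) = R" using geodesic_ray_dist_start[OF a(4), of R] a(5) R by simp
      moreover have "b \<in> ray_image \<beta>" "\<gamma> \<xi> R \<in> ray_image (\<gamma> \<xi>)"
        using \<beta>(3) R by (auto simp: ray_image_def)
      ultimately show ?thesis using True unfolding fellow_travels_def by force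
    next
      case False
      have K: "1 \<le> K" and C: "0 \<le> C" using \<beta>(2) by (auto simp: quasi_geodesic_on_def)
      have "K * 1 \<le> K * K" using K by (intro mult_left_mono) auto
      then have "K \<le> K\<^sup>2" by (simp add: power2_eq_square)
      then have KR: "K \<le> R" "C \<le> R"
        using False kappa_lower_bounds(1)[of K "\<rho> \<xi>" C] kappa_lower_bounds(2)[of C "\<rho> \<xi>" K] K C
        by linarith+
      define \<beta>' where "\<beta>' = \<beta>(0 := b')"
      have qg': "quasi_geodesic_on K (C + D) {0..} \<beta>'"
        using quasi_geodesic_on_rebase[OF \<beta>(2), of b'] \<beta>(3) by (simp add: \<beta>'_def D_def)
      have "\<beta>' \<in> \<eta>"
        by (rule Morse_boundary_change_rep[OF \<eta>M \<beta>(1), of _ D])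
          (use qg' D \<beta>(3) in \<open>auto simp: quasi_geodesic_rays_def \<beta>'_def D_def\<close>)
      then have "fellow_travels b' (\<rho>' \<xi>) (\<gamma>' \<xi>) R' K (C + D) \<beta>'"
        using \<eta> qg' by (simp add: FQ_nbhd_def \<beta>'_def)
      then obtain T q where T: "T \<ge> 0" and q: "q \<in> ray_image (\<gamma>' \<xi>)" "R' \<le> dist b' q"
        and "dist (\<beta>' T) q \<le> kappa (\<rho>' \<xi>) K (C + D)"
        unfolding fellow_travels_def
        by (auto simp: ray_image_def[of \<beta>'] not_less)
      then have d: "dist (\<beta>' T) q \<le> k'"
        using kappa_mono[OF a'(1), of K R "C + D" "R + D"] K KR by (simp add: k'_def)
      have "k' < R'" using R k H D by (simp add: R'_def)
      \<comment> \<open>The modified value \<open>b'\<close> is too far from \<open>q\<close>, so the point found lies on \<open>\<beta>\<close> itself.\<close>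
      then have "T \<noteq> 0" using d q(2) by (auto simp: \<beta>'_def)
      then have d: "dist (\<beta> T) q \<le> k'" using d by (simp add: \<beta>'_def)
      obtain y where y: "y \<in> ray_image (\<gamma> \<xi>)" "dist q y \<le> H" using H(2)[OF q(1)] by blast
      have "infdist (\<beta> T) (ray_image (\<gamma> \<xi>)) \<le> k' + H"
        using infdist_le[OF y(1), of "\<beta> T"] y(2) d dist_triangle[of "\<beta> T" y q] by simp
      moreover have "kappa (\<rho> \<xi>) K C \<le> k"
        using kappa_mono[OF a(1), of K R C R] K KR by (simp add: k_def)
      moreover have "dist b' q \<le> D + dist b (\<beta> T) + dist (\<beta> T) q" unfolding D_def by metric
      ultimately show ?thesis
        using fellow_travels_if_far_point_close[OF proper a(2,1,5) \<beta>(2,3) T, of "k' + H" R] q(2) d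
        by (simp add: R'_def)
    qed
    then show "\<eta> \<in> FQ_nbhd b (\<rho> \<xi>) (\<gamma> \<xi>) R" using \<eta>M by (simp add: FQ_nbhd_def)
  qed
  ultimately show ?thesis by blast
qed

text \<open>
  A geodesic representative of \<open>\<eta>\<close> starting at \<open>b'\<close> is supplied by the choice \<open>\<gamma>'\<close> at \<open>\<eta>\<close> itself.
\<close>

lemma FG_nbhd_change_base:
  fixes b b' :: "'a::metric_space"
  assumes proper: "proper_space TYPE('a)" and cat: "CAT0_space TYPE('a)"
    and adm: "admissible_choice b \<rho> \<gamma>" "admissible_choice b' \<rho>' \<gamma>'"
    and \<xi>: "\<xi> \<in> Morse_boundary" and R: "0 < R"
  shows "\<exists>R'>0. FG_nbhd b' (\<rho>' \<xi>) (\<gamma>' \<xi>) R' \<subseteq> FG_nbhd b (\<rho> \<xi>) (\<gamma> \<xi>) R"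
proof -
  note a = admissible_choiceD[OF adm(1) \<xi>] and a' = admissible_choiceD[OF adm(2) \<xi>]
  obtain H where H: "0 \<le> H" "\<And>x. x \<in> ray_image (\<gamma>' \<xi>) \<Longrightarrow> \<exists>y\<in>ray_image (\<gamma> \<xi>). dist x y \<le> H"
    using Morse_boundary_reps_close[OF \<xi> a'(3) a(3)] by blast
  define D where "D = dist b b'"
  define k where "k = kappa (\<rho> \<xi>) 1 0"
  define k' where "k' = kappa (\<rho>' \<xi>) 1 0"
  define R' where "R' = R + 6 * k + 4 * (D + k' + H) + k' + 2 * D + 1"
  have D: "0 \<le> D" by (simp add: D_def)
  have k: "0 \<le> k" "0 \<le> k'"
    using kappa_lower_bounds(2)[of 0 "\<rho> \<xi>" 1] kappa_lower_bounds(2)[of 0 "\<rho>' \<xi>" 1]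
    by (auto simp: k_def k'_def)
  have "R' > 0" using R k H D by (simp add: R'_def)
  moreover have "FG_nbhd b' (\<rho>' \<xi>) (\<gamma>' \<xi>) R' \<subseteq> FG_nbhd b (\<rho> \<xi>) (\<gamma> \<xi>) R"
  proof
    fix \<eta> assume \<eta>: "\<eta> \<in> FG_nbhd b' (\<rho>' \<xi>) (\<gamma>' \<xi>) R'"
    then have \<eta>M: "\<eta> \<in> Morse_boundary" by (simp add: FG_nbhd_def)
    have "fellow_travels b (\<rho> \<xi>) (\<gamma> \<xi>) R 1 0 \<beta>" if "\<beta> \<in> geodesic_reps b \<eta>" for \<beta>
    proof -
      have \<beta>: "\<beta> \<in> \<eta>" "geodesic_ray \<beta>" "\<beta> 0 = b" using that by (auto simp: geodesic_reps_def)
      define \<beta>' where "\<beta>' = \<gamma>' \<eta>"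
      note b' = admissible_choiceD(3-5)[OF adm(2) \<eta>M, folded \<beta>'_def]
      obtain E where E: "\<And>x. x \<in> ray_image \<beta>' \<Longrightarrow> \<exists>y\<in>ray_image \<beta>. dist x y \<le> E"
        using Morse_boundary_reps_close[OF \<eta>M b'(1) \<beta>(1)] by blast
      have asym: "dist (\<beta> t) (\<beta>' t) \<le> D" if "0 \<le> t" for t
        using CAT0_asymptotic_rays[OF cat \<beta>(2) b'(2) E that] \<beta>(3) b'(3) by (simp add: D_def)
      have "fellow_travels b' (\<rho>' \<xi>) (\<gamma>' \<xi>) R' 1 0 \<beta>'"
        using \<eta> b' by (simp add: FG_nbhd_def geodesic_reps_def)
      then obtain T q where T: "T \<ge> 0" and q: "q \<in> ray_image (\<gamma>' \<xi>)" "R' \<le> dist b' q"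
        and d: "dist (\<beta>' T) q \<le> k'"
        unfolding fellow_travels_def k'_def
        by (auto simp: ray_image_def[of \<beta>'] not_less)
      have d: "dist (\<beta> T) q \<le> D + k'"
        using asym[OF T] d dist_triangle[of "\<beta> T" q "\<beta>' T"] by simp
      obtain y where y: "y \<in> ray_image (\<gamma> \<xi>)" "dist q y \<le> H" using H(2)[OF q(1)] by blast
      have "infdist (\<beta> T) (ray_image (\<gamma> \<xi>)) \<le> D + k' + H"
        using infdist_le[OF y(1), of "\<beta> T"] y(2) d dist_triangle[of "\<beta> T" y q] by simp
      moreover have "dist b' q \<le> D + dist b (\<beta> T) + dist (\<beta> T) q" unfolding D_def by metric
      moreover have qg: "quasi_geodesic_on 1 0 {0..} \<beta>"
        using \<beta>(2) by (auto simp: quasi_geodesic_on_def geodesic_ray_def)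
      ultimately show ?thesis
        using fellow_travels_if_far_point_close[OF proper a(2,1,5) qg \<beta>(3) T, of "D + k' + H" R]
          q(2) d
        by (simp add: R'_def k_def)
    qed
    then show "\<eta> \<in> FG_nbhd b (\<rho> \<xi>) (\<gamma> \<xi>) R" using \<eta>M by (simp add: FG_nbhd_def)
  qed
  ultimately show ?thesis by blast
qed

theorem proposition2p2:
  assumes "proper_space TYPE('a::metric_space)"
    and "geodesic_space TYPE('a)"
  shows "(\<forall>(b::'a) b' \<rho> \<gamma> \<rho>' \<gamma>'.
            admissible_choice b \<rho> \<gamma> \<longrightarrow> admissible_choice b' \<rho>' \<gamma>' \<longrightarrow>
            FQ b \<rho> \<gamma> = FQ b' \<rho>' \<gamma>')
       \<and> (CAT0_space TYPE('a) \<longrightarrow>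
          (\<forall>(b::'a) b' \<rho> \<gamma> \<rho>' \<gamma>'.
            admissible_choice b \<rho> \<gamma> \<longrightarrow> admissible_choice b' \<rho>' \<gamma>' \<longrightarrow>
            FG b \<rho> \<gamma> = FG b' \<rho>' \<gamma>'))"
proof -
  have FQ: "openin (FQ b' \<rho>' \<gamma>') U"
    if adm: "admissible_choice b \<rho> \<gamma>" "admissible_choice b' \<rho>' \<gamma>'" and U: "openin (FQ b \<rho> \<gamma>) U"
    for b b' :: 'a and \<rho> \<rho>' \<gamma> \<gamma>' U
    unfolding openin_FQ
  proof (intro conjI ballI)
    show "U \<subseteq> Morse_boundary" using U by (simp add: openin_FQ)
    fix \<xi> assume "\<xi> \<in> U"
    then obtain R where "R > 0" "FQ_nbhd b (\<rho> \<xi>) (\<gamma> \<xi>) R \<subseteq> U" "\<xi> \<in> Morse_boundary"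
      using U unfolding openin_FQ by blast
    then show "\<exists>R>0. FQ_nbhd b' (\<rho>' \<xi>) (\<gamma>' \<xi>) R \<subseteq> U"
      using FQ_nbhd_change_base[OF assms(1) adm] by (meson order_trans)
  qed
  have FG: "openin (FG b' \<rho>' \<gamma>') U"
    if cat: "CAT0_space TYPE('a)"
      and adm: "admissible_choice b \<rho> \<gamma>" "admissible_choice b' \<rho>' \<gamma>'" and U: "openin (FG b \<rho> \<gamma>) U"
    for b b' :: 'a and \<rho> \<rho>' \<gamma> \<gamma>' U
    unfolding openin_FG
  proof (intro conjI ballI)
    show "U \<subseteq> Morse_boundary" using U by (simp add: openin_FG)
    fix \<xi> assume "\<xi> \<in> U"
    then obtain R where "R > 0" "FG_nbhd b (\<rho> \<xi>) (\<gamma> \<xi>) R \<subseteq> U" "\<xi> \<in> Morse_boundary"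
      using U unfolding openin_FG by blast
    then show "\<exists>R>0. FG_nbhd b' (\<rho>' \<xi>) (\<gamma>' \<xi>) R \<subseteq> U"
      using FG_nbhd_change_base[OF assms(1) cat adm] by (meson order_trans)
  qed
  have "FQ b \<rho> \<gamma> = FQ b' \<rho>' \<gamma>'"
    if "admissible_choice b \<rho> \<gamma>" "admissible_choice b' \<rho>' \<gamma>'" for b b' :: 'a and \<rho> \<rho>' \<gamma> \<gamma>'
    using FQ[OF that] FQ[OF that(2,1)] by (auto simp: topology_eq)
  moreover have "FG b \<rho> \<gamma> = FG b' \<rho>' \<gamma>'"
    if "CAT0_space TYPE('a)" "admissible_choice b \<rho> \<gamma>" "admissible_choice b' \<rho>' \<gamma>'"
    for b b' :: 'a and \<rho> \<rho>' \<gamma> \<gamma>'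
    using FG[OF that] FG[OF that(1,3,2)] by (auto simp: topology_eq)
  ultimately show ?thesis by (intro conjI allI impI)
qed

end
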